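(* Let $\mathcal{H}$ be a real Hilbert space and let $\mathcal{A}:\mathcal{H}\to 2^{\mathcal{H}}$, $\mathcal{Q}:\mathcal{H}\to\mathcal{H}$, $\mathcal{B}:\mathcal{H}\to\mathcal{H}$ satisfy: (1) $\mathcal{A}$ is maximally monotone; (2) $\mathcal{Q}$ is linear, bounded, self-adjoint; (3) $\mathcal{Q}$ is degenerate, i.e. positive semi-definite with $\ker\mathcal{Q}\setminus\{0\}\neq\emptyset$; (4) $\mathrm{ran}\,\mathcal{Q}$ is closed; (5) $\mathcal{B}$ is $\beta^{-1}$-cocoercive with $\beta\in[0,+\infty[$ and $\mathrm{dom}\,\mathcal{B}=\mathcal{H}$; (6) $\mathrm{ran}\,\mathcal{B}\subseteq\mathrm{ran}\,\mathcal{Q}$; (7) $\mathrm{ran}(\mathcal{A}+\mathcal{Q})\supseteq\mathrm{ran}(\mathcal{Q}-\mathcal{B})$; (8) $\mathrm{zer}(\mathcal{A}+\mathcal{B})\neq\emptyset$. Let $\nu\in\,]0,+\infty[$ be a constant with $\|\mathcal{Q}x\|\ge\nu\|x\|$ for all $x\in(\ker\mathcal{Q})^\perp=\mathrm{ran}\,\mathcal{Q}$. Let $x^0\in\mathcal{H}$ and let $\{x^k\}_{k\in\mathbb{N}}$ be generated by $x^{k+1}:=\mathcal{T}x^k$ with $\mathcal{T}=(\mathcal{A}+\mathcal{Q})^{-1}(\mathcal{Q}-\mathcal{B})$. If $\nu>\beta/2$, then: (i) $\{\mathcal{Q}x^k\}_{k\in\mathbb{N}}$ has finite length in the sense that $\sum_{k=0}^\infty\|x^{k+1}-x^k\|_{\mathcal{Q}}^2<\infty$.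 (ii) $\mathcal{Q}(x^k-x^{k+1})\to 0$ (strongly) as $k\to\infty$. (iii) For every $x^\star\in\mathrm{zer}(\mathcal{A}+\mathcal{B})$ and every $k\in\mathbb{N}$, $$\|x^{k+1}-x^k\|_{\mathcal{Q}}\le\frac{1}{\sqrt{k+1}}\sqrt{\frac{2\nu}{2\nu-\beta}}\,\|x^0-x^\star\|_{\mathcal{Q}}.$$ (iv) There exists $x^\star\in\mathrm{zer}(\mathcal{A}+\mathcal{B})$ such that $\mathcal{Q}x^k\rightharpoonup\mathcal{Q}x^\star$ (weakly) as $k\to\infty$.
   Context: $\|x\|_{\mathcal{Q}}^2:=\langle\mathcal{Q}x|x\rangle$ (a seminorm when $\mathcal{Q}$ is degenerate). $\mathrm{zer}(\mathcal{A}+\mathcal{B})=\{x:0\in\mathcal{A}x+\mathcal{B}x\}$. $\mathcal{B}$ is $\beta^{-1}$-cocoercive if $\langle x_1-x_2|\mathcal{B}x_1-\mathcal{B}x_2\rangle\ge\beta^{-1}\|\mathcal{B}x_1-\mathcal{B}x_2\|^2$ for all $x_1,x_2$; by convention the case $\beta=0$ means $\mathcal{B}=0$. The operator $\mathcal{T}$ is treated as an everywhere defined operator $\mathcal{H}\to\mathcal{H}$ (condition (7) gives $\mathrm{dom}\,\mathcal{T}=\mathcal{H}$); the iteration is equivalently $0\in\mathcal{A}x^{k+1}+\mathcal{B}x^k+\mathcal{Q}(x^{k+1}-x^k)$. *)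

theory Defs
  imports "HOL-Analysis.Analysis"
begin

text \<open>
  A set-valued operator on a Hilbert space is a function into sets; the graph of \<open>A\<close> is
  the set of pairs \<open>(x, u)\<close> with \<open>u \<in> A x\<close>. Single-valued operators with full domain are
  plain functions. Sums of values are the Minkowski sums of \<open>HOL-Library.Set_Algebras\<close>.
\<close>

definition monotone_op :: "('a::real_inner \<Rightarrow> 'a set) \<Rightarrow> bool" where
  "monotone_op A \<longleftrightarrow> (\<forall>x y. \<forall>u\<in>A x. \<forall>v\<in>A y. inner (x - y) (u - v) \<ge> 0)"

text \<open>Maximality is with respect to inclusion of graphs.\<close>

definition maximally_monotone :: "('a::real_inner \<Rightarrow> 'a set) \<Rightarrow> bool" where
  "maximally_monotone A \<longleftrightarrow>
     monotone_op A \<and> (\<forall>A'. monotone_op A' \<and> (\<forall>x. A x \<subseteq> A' x) \<longrightarrow> A' = A)"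

definition op_ran :: "('a \<Rightarrow> 'b set) \<Rightarrow> 'b set" where
  "op_ran A = (\<Union>x. A x)"

definition op_inverse :: "('a \<Rightarrow> 'b set) \<Rightarrow> 'b \<Rightarrow> 'a set" where
  "op_inverse A u = {x. u \<in> A x}"

definition zer :: "('a \<Rightarrow> 'b::zero set) \<Rightarrow> 'a set" where
  "zer A = {x. 0 \<in> A x}"

text \<open>
  The case \<open>\<beta> = 0\<close> is separate because \<open>\<beta>\<inverse>\<close> is then not meaningful
  (in HOL it would be \<open>0\<close>); by convention it means \<open>B = 0\<close>.
\<close>

definition inv_cocoercive :: "real \<Rightarrow> ('a::real_inner \<Rightarrow> 'a) \<Rightarrow> bool" where
  "inv_cocoercive \<beta> B \<longleftrightarrow>
     (if \<beta> = 0 then (\<forall>x. B x = 0)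
      else (\<forall>x y. inner (x - y) (B x - B y) \<ge> inverse \<beta> * (norm (B x - B y))\<^sup>2))"

definition self_adjoint :: "('a::real_inner \<Rightarrow> 'a) \<Rightarrow> bool" where
  "self_adjoint Q \<longleftrightarrow> (\<forall>x y. inner (Q x) y = inner x (Q y))"

definition op_ker :: "('a \<Rightarrow> 'b::zero) \<Rightarrow> 'a set" where
  "op_ker Q = {x. Q x = 0}"

definition degenerate :: "('a::real_inner \<Rightarrow> 'a) \<Rightarrow> bool" where
  "degenerate Q \<longleftrightarrow> (\<forall>x. inner (Q x) x \<ge> 0) \<and> op_ker Q - {0} \<noteq> {}"

definition qnorm :: "('a::real_inner \<Rightarrow> 'a) \<Rightarrow> 'a \<Rightarrow> real" where
  "qnorm Q x = sqrt (inner (Q x) x)"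

text \<open>
  The forward-backward operator \<open>(A + Q)\<inverse> (Q - B)\<close>. Since \<open>Q\<close> is not injective, the inverse
  may be multi-valued, so the operator is kept set-valued and the recursion
  \<open>x\<^sub>k\<^sub>+\<^sub>1 = T x\<^sub>k\<close> is read as \<open>x\<^sub>k\<^sub>+\<^sub>1 \<in> T x\<^sub>k\<close>, i.e. as
  \<open>0 \<in> A x\<^sub>k\<^sub>+\<^sub>1 + B x\<^sub>k + Q (x\<^sub>k\<^sub>+\<^sub>1 - x\<^sub>k)\<close> for linear \<open>Q\<close>.
\<close>

definition fb_op ::
    "('a::real_inner \<Rightarrow> 'a set) \<Rightarrow> ('a \<Rightarrow> 'a) \<Rightarrow> ('a \<Rightarrow> 'a) \<Rightarrow> 'a \<Rightarrow> 'a set" where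
  "fb_op A B Q x = op_inverse (\<lambda>y. A y + {Q y}) (Q x - B x)"

text \<open>Weak convergence, with functionals represented by the inner product.\<close>

definition weakly_converges :: "(nat \<Rightarrow> 'a::real_inner) \<Rightarrow> 'a \<Rightarrow> bool" where
  "weakly_converges X l \<longleftrightarrow> (\<forall>z. (\<lambda>k. inner (X k) z) \<longlonglongrightarrow> inner l z)"

end

theory Submission
  imports Defs
begin

text \<open>
  Write \<open>q x = \<langle>Q x, x\<rangle>\<close>. Since \<open>B\<close> maps into the range of \<open>Q\<close>, on which \<open>q\<close> is coercive with
  constant \<open>\<nu>\<close>, the failure of cocoercivity caused by evaluating \<open>B\<close> at the old point costs at most
  \<open>\<beta> / (4 \<nu>) q (d)\<close>; hence the forward-backward operator is averaged with respect to \<open>q\<close>. This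
  gives Fejer monotonicity, decreasing step lengths, and the first three claims.

  For weak convergence no weak compactness is used: the asymptotic center of the iterates along
  any filter exists by the parallelogram law and completeness of the range of \<open>Q\<close>, it is fixed by
  the nonexpansive operator modulo the kernel of \<open>Q\<close>, and an application of the operator turns it
  into a genuine zero of \<open>A + B\<close> with the same image under \<open>Q\<close>.
\<close>

section \<open>Minimization by uniform convexity and completeness\<close>

text \<open>The quadratic gain at midpoints makes every minimizing sequence Cauchy, so completeness
  supplies a minimizer without weak compactness. It is applied to squared distances, which yields
  projections, and to asymptotic radii.\<close>

lemma midpoint_convex_attains_inf:
  fixes f :: "'a::{real_inner, complete_space} \<Rightarrow> real"
  assumes "closed S" and "S \<noteq> {}" and "c > 0"
    and mid: "\<And>u v. u \<in> S \<Longrightarrow> v \<in> S \<Longrightarrow> (1/2) *\<^sub>R (u + v) \<in> S"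
    and nonneg: "\<And>u. u \<in> S \<Longrightarrow> 0 \<le> f u"
    and conv: "\<And>u v. u \<in> S \<Longrightarrow> v \<in> S \<Longrightarrow>
      f ((1/2) *\<^sub>R (u + v)) \<le> (f u + f v) / 2 - c * (norm (u - v))\<^sup>2"
    and lsc: "\<And>X l m. (\<And>n. X n \<in> S) \<Longrightarrow> l \<in> S \<Longrightarrow> X \<longlonglongrightarrow> l \<Longrightarrow>
      (\<lambda>n. f (X n)) \<longlonglongrightarrow> m \<Longrightarrow> f l \<le> m"
  shows "\<exists>w\<in>S. \<forall>v\<in>S. f w \<le> f v"
proof -
  define m where "m = Inf (f ` S)"
  have bdd: "bdd_below (f ` S)"
    using nonneg by (auto intro!: bdd_belowI[of _ 0])
  have m_le: "m \<le> f u" if "u \<in> S" for u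
    unfolding m_def using bdd that by (simp add: cInf_lower)
  have "\<exists>u\<in>S. f u < m + 1 / (real n + 1)" for n
  proof -
    have "Inf (f ` S) < m + 1 / (real n + 1)"
      unfolding m_def by simp
    then show ?thesis
      using cInf_lessD[of "f ` S"] \<open>S \<noteq> {}\<close> by auto
  qed
  then obtain X where X: "\<And>n. X n \<in> S" "\<And>n. f (X n) < m + 1 / (real n + 1)"
    by metis
  have inv0: "(\<lambda>n. 1 / (real n + 1)) \<longlonglongrightarrow> 0"
    using LIMSEQ_inverse_real_of_nat by (simp add: field_simps)
  \<comment> \<open>The midpoint of two almost minimizers still has value at least \<open>m\<close>,
    so the gain \<open>c * (norm (X i - X j))\<^sup>2\<close> cannot exceed their excess over
    \<open>m\<close>.\<close>
  have dist_le: "c * (norm (X i - X j))\<^sup>2 \<le> 1 / (real N + 1)" if "i \<ge> N" "j \<ge> N" for i j N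
  proof -
    have "m \<le> (f (X i) + f (X j)) / 2 - c * (norm (X i - X j))\<^sup>2"
      using m_le[OF mid] conv X(1) by (meson order_trans)
    moreover have "f (X i) < m + 1 / (real N + 1)" "f (X j) < m + 1 / (real N + 1)"
      using that X(2)[of i] X(2)[of j]
      by (auto intro!: less_le_trans[OF X(2)] divide_left_mono)
    ultimately show ?thesis by argo
  qed
  have "Cauchy X"
  proof (rule metric_CauchyI)
    fix e :: real assume "e > 0"
    then have "c * e\<^sup>2 > 0" using \<open>c > 0\<close> by simp
    then have "\<forall>\<^sub>F n in sequentially. 1 / (real n + 1) < c * e\<^sup>2"
      using order_tendstoD(2)[OF inv0] by blast
    then obtain N where N: "1 / (real N + 1) < c * e\<^sup>2"
      by (auto simp: eventually_sequentially)
    have "dist (X i) (X j) < e" if "i \<ge> N" "j \<ge> N" for i j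
    proof -
      have "c * (norm (X i - X j))\<^sup>2 < c * e\<^sup>2"
        using dist_le[OF that] N by linarith
      then have "(norm (X i - X j))\<^sup>2 < e\<^sup>2" using \<open>c > 0\<close> by simp
      then show ?thesis
        using \<open>e > 0\<close> by (simp add: dist_norm power_less_imp_less_base)
    qed
    then show "\<exists>M. \<forall>i\<ge>M. \<forall>j\<ge>M. dist (X i) (X j) < e" by blast
  qed
  then obtain l where l: "X \<longlonglongrightarrow> l"
    using Cauchy_convergent convergent_def by blast
  have "l \<in> S"
    using closed_sequentially[OF \<open>closed S\<close> _ l] X(1) by blast
  have "(\<lambda>n. m + 1 / (real n + 1)) \<longlonglongrightarrow> m + 0"
    by (intro tendsto_intros inv0)
  then have "(\<lambda>n. f (X n)) \<longlonglongrightarrow> m"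
    using tendsto_sandwich[of "\<lambda>_. m" "\<lambda>n. f (X n)" sequentially "\<lambda>n. m + 1 / (real n + 1)" m]
      m_le[OF X(1)] less_imp_le[OF X(2)] by simp
  from lsc[OF X(1) \<open>l \<in> S\<close> l this] show ?thesis
    using m_le \<open>l \<in> S\<close> by (meson order_trans)
qed

lemma closed_subspace_projection:
  fixes S :: "'a::{real_inner, complete_space} set"
  assumes "closed S" and "subspace S"
  shows "\<exists>p\<in>S. \<forall>z\<in>S. inner (x - p) z = 0"
proof -
  have "\<exists>p\<in>S. \<forall>v\<in>S. (norm (x - p))\<^sup>2 \<le> (norm (x - v))\<^sup>2"
  proof (rule midpoint_convex_attains_inf[where c = "1/4"])
    show "S \<noteq> {}" using \<open>subspace S\<close> subspace_0 by blast
    show "(1/2) *\<^sub>R (u + v) \<in> S" if "u \<in> S" "v \<in> S" for u v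
      using \<open>subspace S\<close> that by (simp add: subspace_add subspace_scale)
    show "(norm (x - (1/2) *\<^sub>R (u + v)))\<^sup>2
        \<le> ((norm (x - u))\<^sup>2 + (norm (x - v))\<^sup>2) / 2 - 1/4 * (norm (u - v))\<^sup>2" for u v
      by (simp add: power2_norm_eq_inner inner_simps inner_commute field_simps)
    show "(norm (x - l))\<^sup>2 \<le> m"
      if "X \<longlonglongrightarrow> l" "(\<lambda>n. (norm (x - X n))\<^sup>2) \<longlonglongrightarrow> m" for X l m
    proof -
      have "(\<lambda>n. (norm (x - X n))\<^sup>2) \<longlonglongrightarrow> (norm (x - l))\<^sup>2"
        by (intro tendsto_intros that)
      then show ?thesis using that LIMSEQ_unique by blast
    qed
  qed (use assms in auto)
  then obtain p where p: "p \<in> S" "\<And>v. v \<in> S \<Longrightarrow> (norm (x - p))\<^sup>2 \<le> (norm (x - v))\<^sup>2"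
    by blast
  have "inner (x - p) z = 0" if "z \<in> S" for z
  proof (rule ccontr)
    assume nz: "inner (x - p) z \<noteq> 0"
    then have zz: "inner z z > 0" by auto
    \<comment> \<open>This \<open>t\<close> minimizes the squared norm of
      \<open>(x - p) - t *\<^sub>R z\<close>; the strict decrease it produces contradicts the choice
      of \<open>p\<close>.\<close>
    define t where "t = inner (x - p) z / inner z z"
    have "p + t *\<^sub>R z \<in> S"
      using \<open>subspace S\<close> that p(1) by (simp add: subspace_add subspace_scale)
    from p(2)[OF this] have "0 \<le> (norm ((x - p) - t *\<^sub>R z))\<^sup>2 - (norm (x - p))\<^sup>2"
      by (simp add: algebra_simps)
    also have "\<dots> = t\<^sup>2 * inner z z - 2 * t * inner (x - p) z"
    proof -
      have "inner (a - t *\<^sub>R z) (a - t *\<^sub>R z) = inner a a - 2 * t * inner a z + t\<^sup>2 * inner z z"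
        for a
        by (simp add: inner_diff_left inner_diff_right inner_commute[of z a] power2_eq_square
            right_diff_distrib)
      then show ?thesis unfolding power2_norm_eq_inner by simp
    qed
    also have "\<dots> = - ((inner (x - p) z)\<^sup>2 / inner z z)"
      unfolding t_def using zz by (simp add: field_simps power2_eq_square)
    finally show False using nz zz
      by (smt (verit) divide_pos_pos zero_less_power2)
  qed
  then show ?thesis using p(1) by blast
qed

section \<open>Upper limits of real functions along a filter\<close>

text \<open>Meaningful only for functions that are eventually bounded along a nontrivial filter.\<close>
definition real_limsup :: "'b filter \<Rightarrow> ('b \<Rightarrow> real) \<Rightarrow> real" where
  "real_limsup F g = Inf {c. \<forall>\<^sub>F k in F. g k \<le> c}"

lemma real_limsup_le:
  assumes "F \<noteq> bot" and "\<And>k. 0 \<le> g k" and "\<forall>\<^sub>F k in F. g k \<le> c"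
  shows "real_limsup F g \<le> c"
proof -
  have "0 \<le> d" if "\<forall>\<^sub>F k in F. g k \<le> d" for d
    using eventually_happens'[OF assms(1) that] assms(2) by (meson order_trans)
  then have "bdd_below {c. \<forall>\<^sub>F k in F. g k \<le> c}"
    by (intro bdd_belowI[of _ 0]) simp
  then show ?thesis
    unfolding real_limsup_def using assms(3) by (simp add: cInf_lower)
qed

lemma real_limsup_upper:
  assumes "\<forall>\<^sub>F k in F. g k \<le> K" and "e > 0"
  shows "\<forall>\<^sub>F k in F. g k \<le> real_limsup F g + e"
proof -
  have "Inf {c. \<forall>\<^sub>F k in F. g k \<le> c} < real_limsup F g + e"
    unfolding real_limsup_def using assms by simp
  then obtain c where "\<forall>\<^sub>F k in F. g k \<le> c" "c < real_limsup F g + e"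
    using cInf_lessD[of "{c. \<forall>\<^sub>F k in F. g k \<le> c}"] assms(1) by blast
  then show ?thesis by (auto elim: eventually_mono)
qed

lemma real_limsup_nonneg:
  assumes "F \<noteq> bot" and "\<And>k. 0 \<le> g k" and "\<forall>\<^sub>F k in F. g k \<le> K"
  shows "0 \<le> real_limsup F g"
proof (rule field_le_epsilon)
  fix e :: real assume "e > 0"
  show "0 \<le> real_limsup F g + e"
    using eventually_happens'[OF assms(1) real_limsup_upper[OF assms(3) \<open>e > 0\<close>]] assms(2)
    by (meson order_trans)
qed

text \<open>The slack \<open>e\<close> absorbs error terms that merely vanish along the filter, and
  \<open>c\<close> may be negative, so a strict decrease of the upper limit can be recorded as
  well.\<close>

lemma real_limsup_le_add:
  assumes "F \<noteq> bot" and "\<And>k. 0 \<le> g k" and "\<forall>\<^sub>F k in F. h k \<le> K"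
    and "\<And>e. e > 0 \<Longrightarrow> \<forall>\<^sub>F k in F. g k \<le> h k + c + e"
  shows "real_limsup F g \<le> real_limsup F h + c"
proof (rule field_le_epsilon)
  fix e :: real assume "e > 0"
  then have "e / 2 > 0" by simp
  from real_limsup_upper[OF assms(3) this] assms(4)[OF this]
  have "\<forall>\<^sub>F k in F. g k \<le> real_limsup F h + c + e"
    by eventually_elim linarith
  then show "real_limsup F g \<le> real_limsup F h + c + e"
    by (intro real_limsup_le assms)
qed

lemma real_limsup_eq_lim:
  assumes "F \<noteq> bot" and "\<And>k. 0 \<le> g k" and "(g \<longlongrightarrow> l) F"
  shows "real_limsup F g = l"
proof (rule antisym)
  have ev: "\<forall>\<^sub>F k in F. g k \<le> l + e" if "e > 0" for e
    using order_tendstoD(2)[OF assms(3), of "l + e"] that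
    by (auto elim: eventually_mono)
  show "real_limsup F g \<le> l"
    by (rule field_le_epsilon) (intro real_limsup_le assms ev)
  show "l \<le> real_limsup F g"
  proof (rule field_le_epsilon)
    fix e :: real assume "e > 0"
    show "l \<le> real_limsup F g + e"
      using tendsto_upperbound[OF assms(3) real_limsup_upper[OF ev[of 1] \<open>e > 0\<close>] assms(1)]
      by simp
  qed
qed

section \<open>Geometry of the seminorm induced by \<open>Q\<close>\<close>

locale psd_closed_range =
  fixes Q :: "'a::{real_inner, complete_space} \<Rightarrow> 'a" and \<nu> :: real
  assumes bounded_linear: "bounded_linear Q"
    and self_adjoint: "self_adjoint Q"
    and psd: "\<And>x. 0 \<le> inner (Q x) x"
    and closed_range: "closed (range Q)"
    and \<nu>_pos: "\<nu> > 0"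
    and lower_bound: "\<And>y. y \<in> orthogonal_comp (op_ker Q) \<Longrightarrow> \<nu> * norm y \<le> norm (Q y)"
begin

abbreviation q :: "'a \<Rightarrow> real" where
  "q x \<equiv> inner (Q x) x"

lemma linear: "linear Q"
  using bounded_linear by (rule bounded_linear.linear)

lemmas lin = linear_add[OF linear] linear_diff[OF linear] linear_scale[OF linear]
  linear_0[OF linear] linear_neg[OF linear]

lemma sym: "inner (Q x) y = inner (Q y) x"
  using self_adjoint unfolding self_adjoint_def by (metis inner_commute)

lemma qnorm_sq: "(qnorm Q x)\<^sup>2 = q x"
  by (simp add: qnorm_def psd)

lemma q_add: "q (x + y) = q x + 2 * inner (Q x) y + q y"
  using sym[of x y] by (simp add: lin inner_simps)

lemma q_diff: "q (x - y) = q x - 2 * inner (Q x) y + q y"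
  using sym[of x y] by (simp add: lin inner_simps)

lemma q_scale: "q (t *\<^sub>R x) = t\<^sup>2 * q x"
  by (simp add: lin power2_eq_square)

lemma q_commute: "q (x - y) = q (y - x)"
  using sym[of x y] by (simp add: q_diff)

text \<open>Discriminant argument for the nonnegative polynomial
  \<open>q (x - t *\<^sub>R y)\<close> in \<open>t\<close>. As \<open>q\<close> is only a seminorm
  squared, the polynomial may degenerate to an affine function, which is treated separately.\<close>

lemma Cauchy_Schwarz: "(inner (Q x) y)\<^sup>2 \<le> q x * q y"
proof -
  define a b c where "a = q x" and "b = inner (Q x) y" and "c = q y"
  have quad: "0 \<le> a - 2 * t * b + t\<^sup>2 * c" for t
  proof -
    have "q (x - t *\<^sub>R y) = a - 2 * t * b + t\<^sup>2 * c"
      unfolding q_diff[of x] q_scale a_def b_def c_def by simp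
    then show ?thesis using psd[of "x - t *\<^sub>R y"] by simp
  qed
  have c: "c \<ge> 0" by (simp add: c_def psd)
  have "b\<^sup>2 \<le> a * c"
  proof (cases "c = 0")
    case True
    have "b = 0"
    proof (rule ccontr)
      assume "b \<noteq> 0"
      \<comment> \<open>With \<open>c = 0\<close> this choice of \<open>t\<close> gives the
        polynomial the value -1.\<close>
      then show False using quad[of "(a + 1) / (2 * b)"] True by (simp add: field_simps)
    qed
    then show ?thesis using True by simp
  next
    case False
    then show ?thesis
      using quad[of "b / c"] c by (simp add: field_simps power2_eq_square)
  qed
  then show ?thesis by (simp add: a_def b_def c_def)
qed

text \<open>Project \<open>w\<close> orthogonally onto the range. The residual \<open>w - p\<close>
  is orthogonal to \<open>Q (Q (w - p))\<close>, so by self-adjointness \<open>Q (w - p)\<close> is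
  orthogonal to itself.\<close>

lemma range_representative:
  obtains p where "p \<in> range Q" and "Q p = Q w"
proof -
  have "subspace (range Q)"
    using linear by (rule linear_subspace_image) simp
  then obtain p where p: "p \<in> range Q" "\<And>z. z \<in> range Q \<Longrightarrow> inner (w - p) z = 0"
    using closed_subspace_projection[OF closed_range] by blast
  have "inner (Q (w - p)) (Q (w - p)) = 0"
    using p(2)[of "Q (Q (w - p))"] sym[of "w - p" "Q (w - p)"]
    by (simp add: inner_commute)
  then show thesis using that[OF p(1)] by (simp add: lin)
qed

text \<open>Replacing \<open>w\<close> by its representative \<open>p\<close> in the range leaves
  \<open>q\<close> unchanged. There \<open>p\<close> is orthogonal to the kernel, so the lower bound
  controls \<open>norm p\<close> in the estimate of \<open>inner (Q w) p\<close>.\<close>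

lemma q_le_norm: "q w \<le> (norm (Q w))\<^sup>2 / \<nu>"
proof -
  obtain p where p: "p \<in> range Q" "Q p = Q w" by (rule range_representative)
  then obtain r where r: "p = Q r" by blast
  have "p \<in> orthogonal_comp (op_ker Q)"
    unfolding orthogonal_comp_def orthogonal_def op_ker_def r
    using sym[of r] by (auto simp: inner_commute)
  from lower_bound[OF this] have "norm p \<le> norm (Q w) / \<nu>"
    using \<nu>_pos p(2) by (simp add: field_simps)
  moreover have "q w = inner (Q w) p"
    using sym[of w p] p(2) by (simp add: inner_commute)
  then have "q w \<le> norm (Q w) * norm p" by (simp add: norm_cauchy_schwarz)
  ultimately have "q w \<le> norm (Q w) * (norm (Q w) / \<nu>)"
    by (meson mult_left_mono norm_ge_zero order_trans)
  then show ?thesis by (simp add: power2_eq_square)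
qed

text \<open>
  With \<open>x = Q r\<close>, Cauchy-Schwarz for \<open>q\<close> gives \<open>\<parallel>x\<parallel>\<^sup>4 \<le> q r * q x\<close>; this replaces the square root
  of \<open>Q\<close>.
\<close>
lemma q_coercive_on_range:
  assumes "x \<in> range Q"
  shows "\<nu> * (norm x)\<^sup>2 \<le> q x"
proof -
  obtain r where r: "x = Q r" using assms by blast
  have "((norm x)\<^sup>2)\<^sup>2 = (inner (Q r) x)\<^sup>2"
    by (simp add: r power2_norm_eq_inner)
  also have "\<dots> \<le> q r * q x" by (rule Cauchy_Schwarz)
  also have "\<dots> \<le> (norm x)\<^sup>2 / \<nu> * q x"
    unfolding r by (intro mult_right_mono q_le_norm psd)
  finally have *: "(norm x)\<^sup>2 * (\<nu> * (norm x)\<^sup>2) \<le> (norm x)\<^sup>2 * q x"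
    using \<nu>_pos by (simp add: field_simps power2_eq_square)
  show ?thesis
  proof (cases "x = 0")
    case False
    then show ?thesis using * by simp
  qed simp
qed

text \<open>Cauchy-Schwarz for \<open>q\<close> at the pair \<open>x\<close>, \<open>Q x\<close>,
  followed by cancelling one factor \<open>(norm (Q x))\<^sup>2\<close>. It turns smallness in the
  seminorm into strong smallness of \<open>Q x\<close>.\<close>

lemma norm_Q_le: "(norm (Q x))\<^sup>2 \<le> onorm Q * q x"
proof -
  have "((norm (Q x))\<^sup>2)\<^sup>2 = (inner (Q x) (Q x))\<^sup>2"
    by (simp add: power2_norm_eq_inner)
  also have "\<dots> \<le> q x * q (Q x)" by (rule Cauchy_Schwarz)
  also have "\<dots> \<le> q x * (norm (Q (Q x)) * norm (Q x))"
    by (intro mult_left_mono norm_cauchy_schwarz psd)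
  also have "\<dots> \<le> q x * (onorm Q * norm (Q x) * norm (Q x))"
    by (intro mult_left_mono mult_right_mono onorm bounded_linear psd) simp
  finally have *: "(norm (Q x))\<^sup>2 * (norm (Q x))\<^sup>2 \<le> (norm (Q x))\<^sup>2 * (onorm Q * q x)"
    by (simp add: power2_eq_square algebra_simps)
  show ?thesis
  proof (cases "Q x = 0")
    case False
    then have "(norm (Q x))\<^sup>2 > 0" by simp
    with * show ?thesis by (rule mult_left_le_imp_le)
  qed (simp add: onorm_pos_le bounded_linear psd)
qed

lemma Q_eq_0_if_q: "q x = 0 \<Longrightarrow> Q x = 0"
  using norm_Q_le[of x] by simp

lemma q_eq_modulo_ker:
  assumes "Q v = Q w"
  shows "q (x - v) = q (x - w)"
proof -
  have "inner (Q x) v = inner (Q x) w" "q v = q w"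
    using sym[of x v] sym[of x w] sym[of v w] assms by auto
  then show ?thesis unfolding q_diff[of x] by simp
qed

text \<open>The parallelogram law; its last term is the source of uniform convexity for asymptotic
  radii.\<close>

lemma q_midpoint: "q (x - (1/2) *\<^sub>R (u + v)) = (q (x - u) + q (x - v)) / 2 - q (u - v) / 4"
proof -
  define a b where "a = x - u" and "b = x - v"
  have "x - (1/2) *\<^sub>R (u + v) = (1/2) *\<^sub>R (a + b)"
    by (simp add: a_def b_def algebra_simps flip: scaleR_add_left)
  moreover have "u - v = b - a" by (simp add: a_def b_def)
  moreover have "q ((1/2) *\<^sub>R (a + b)) = (q a + q b) / 2 - q (b - a) / 4"
    unfolding q_scale q_add[of a] q_diff[of b] using sym[of a b]
    by (simp add: power2_eq_square field_simps)
  ultimately show ?thesis by (simp add: a_def b_def)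
qed

lemma q_bounded:
  assumes "norm (Q u) \<le> K"
  shows "q (u - w) \<le> (K + norm (Q w))\<^sup>2 / \<nu>"
proof -
  have "norm (Q (u - w)) \<le> K + norm (Q w)"
    using norm_triangle_ineq4[of "Q u" "Q w"] assms by (simp add: lin)
  then have "(norm (Q (u - w)))\<^sup>2 \<le> (K + norm (Q w))\<^sup>2" by (simp add: power_mono)
  then show ?thesis
    using q_le_norm[of "u - w"] \<nu>_pos
    by (meson divide_right_mono less_imp_le order_trans)
qed

section \<open>Asymptotic centers and weak convergence\<close>

text \<open>The radius \<open>R\<close> inherits midpoint convexity from \<open>q\<close>, but with
  a gain in \<open>q\<close> only. On the range of \<open>Q\<close> this gain dominates the norm, so
  the minimum is attained there; since \<open>R\<close> is constant modulo the kernel, it is a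
  minimum over the whole space.\<close>

lemma asymptotic_center:
  fixes x :: "'b \<Rightarrow> 'a"
  assumes F: "F \<noteq> bot" and K: "\<And>k. norm (Q (x k)) \<le> K"
  shows "\<exists>w. \<forall>v. real_limsup F (\<lambda>k. q (x k - w)) \<le> real_limsup F (\<lambda>k. q (x k - v))"
proof -
  define R where "R w = real_limsup F (\<lambda>k. q (x k - w))" for w
  have bd: "\<forall>\<^sub>F k in F. q (x k - w) \<le> (K + norm (Q w))\<^sup>2 / \<nu>" for w
    using q_bounded[OF K] by simp
  have R_midpoint: "R ((1/2) *\<^sub>R (u + v)) \<le> (R u + R v) / 2 - q (u - v) / 4" for u v
  proof (rule field_le_epsilon)
    fix e :: real assume "e > 0"
    have "\<forall>\<^sub>F k in F. q (x k - (1/2) *\<^sub>R (u + v)) \<le> (R u + R v) / 2 - q (u - v) / 4 + e"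
      using real_limsup_upper[OF bd \<open>e > 0\<close>, of u] real_limsup_upper[OF bd \<open>e > 0\<close>, of v]
      unfolding q_midpoint R_def[symmetric] by eventually_elim (simp add: field_simps)
    then show "R ((1/2) *\<^sub>R (u + v)) \<le> (R u + R v) / 2 - q (u - v) / 4 + e"
      unfolding R_def[of "(1/2) *\<^sub>R (u + v)"] by (intro real_limsup_le F psd)
  qed
  \<comment> \<open>The difference \<open>q (x k - w) - q (x k - v)\<close> factors as an inner
    product with \<open>v - w\<close> whose other argument is bounded uniformly in \<open>k\<close>.
    This provides the semicontinuity required below.\<close>
  have R_le: "R w \<le> R v + norm (v - w) * (2 * K + norm (Q v) + norm (Q w))" for v w
    unfolding R_def
  proof (rule real_limsup_le_add[OF F psd bd])
    fix e :: real assume "e > 0"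
    have "q (x k - w) \<le> q (x k - v) + norm (v - w) * (2 * K + norm (Q v) + norm (Q w)) + e" for k
    proof -
      have "q (x k - w) - q (x k - v) = inner (Q (x k) + Q (x k) - Q v - Q w) (v - w)"
        using sym[of "x k" w] sym[of "x k" v] sym[of v w]
        by (simp add: lin inner_simps)
      also have "\<dots> \<le> norm (Q (x k) + Q (x k) - Q v - Q w) * norm (v - w)"
        by (rule norm_cauchy_schwarz)
      also have "norm (Q (x k) + Q (x k) - Q v - Q w) \<le> 2 * K + norm (Q v) + norm (Q w)"
        using K[of k] norm_triangle_ineq[of "Q (x k)" "Q (x k)"]
          norm_triangle_ineq4[of "Q (x k) + Q (x k)" "Q v"]
          norm_triangle_ineq4[of "Q (x k) + Q (x k) - Q v" "Q w"] by linarith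
      finally show ?thesis using \<open>e > 0\<close>
        by (simp add: mult_right_mono mult.commute)
    qed
    then show "\<forall>\<^sub>F k in F. q (x k - w)
        \<le> q (x k - v) + norm (v - w) * (2 * K + norm (Q v) + norm (Q w)) + e"
      by simp
  qed
  have sub: "subspace (range Q)"
    using linear by (rule linear_subspace_image) simp
  have "\<exists>w\<in>range Q. \<forall>v\<in>range Q. R w \<le> R v"
  proof (rule midpoint_convex_attains_inf[OF closed_range, where c = "\<nu> / 4"])
    show "(1/2) *\<^sub>R (u + v) \<in> range Q" if "u \<in> range Q" "v \<in> range Q" for u v
      using sub that by (simp add: subspace_add subspace_scale)
    show "0 \<le> R u" for u
      unfolding R_def by (rule real_limsup_nonneg[OF F psd bd])
    show "R ((1/2) *\<^sub>R (u + v)) \<le> (R u + R v) / 2 - \<nu> / 4 * (norm (u - v))\<^sup>2"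
      if "u \<in> range Q" "v \<in> range Q" for u v
      using R_midpoint[of u v] q_coercive_on_range[OF subspace_diff[OF sub that]] by simp
    show "R l \<le> m" if X: "X \<longlonglongrightarrow> l" and m: "(\<lambda>n. R (X n)) \<longlonglongrightarrow> m" for X l m
    proof -
      have "(\<lambda>n. Q (X n)) \<longlonglongrightarrow> Q l"
        by (rule bounded_linear.tendsto[OF bounded_linear X])
      then have "(\<lambda>n. R (X n) + norm (X n - l) * (2 * K + norm (Q (X n)) + norm (Q l)))
          \<longlonglongrightarrow> m + norm (l - l) * (2 * K + norm (Q l) + norm (Q l))"
        by (intro tendsto_intros X m)
      then show ?thesis
        using LIMSEQ_le_const[of _ _ "R l"] R_le by fastforce
    qed
  qed (use \<nu>_pos in auto)
  then obtain w where w: "\<And>v. v \<in> range Q \<Longrightarrow> R w \<le> R v" by blast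
  have "R w \<le> R v" for v
  proof -
    obtain p where p: "p \<in> range Q" "Q p = Q v" by (rule range_representative)
    have "R p = R v" unfolding R_def by (simp only: q_eq_modulo_ker[OF p(2)])
    then show ?thesis using w[OF p(1)] by simp
  qed
  then show ?thesis unfolding R_def by blast
qed

text \<open>Otherwise the midpoint of \<open>w\<close> and \<open>y\<close> would have a radius
  smaller by \<open>q (w - y) / 4\<close>.\<close>

lemma asymptotic_center_unique:
  fixes x :: "'b \<Rightarrow> 'a"
  assumes F: "F \<noteq> bot" and K: "\<And>k. norm (Q (x k)) \<le> K"
    and min: "\<And>v. real_limsup F (\<lambda>k. q (x k - w)) \<le> real_limsup F (\<lambda>k. q (x k - v))"
    and y: "real_limsup F (\<lambda>k. q (x k - y)) \<le> real_limsup F (\<lambda>k. q (x k - w))"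
  shows "Q y = Q w"
proof -
  define r where "r = real_limsup F (\<lambda>k. q (x k - w))"
  have bd: "\<forall>\<^sub>F k in F. q (x k - v) \<le> (K + norm (Q v))\<^sup>2 / \<nu>" for v
    using q_bounded[OF K] by simp
  have "q (w - y) / 4 \<le> 0"
  proof (rule field_le_epsilon)
    fix e :: real assume "e > 0"
    have "\<forall>\<^sub>F k in F. q (x k - (1/2) *\<^sub>R (w + y)) \<le> r + e - q (w - y) / 4"
      using real_limsup_upper[OF bd \<open>e > 0\<close>, of w] real_limsup_upper[OF bd \<open>e > 0\<close>, of y]
      unfolding q_midpoint
    proof eventually_elim
      case (elim k)
      then show ?case using y by (simp add: r_def field_simps)
    qed
    then have "real_limsup F (\<lambda>k. q (x k - (1/2) *\<^sub>R (w + y))) \<le> r + e - q (w - y) / 4"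
      by (intro real_limsup_le F psd)
    then show "q (w - y) / 4 \<le> 0 + e"
      using min[of "(1/2) *\<^sub>R (w + y)"] by (simp add: r_def)
  qed
  then have "q (w - y) = 0" using psd[of "w - y"] by simp
  then show ?thesis using Q_eq_0_if_q[of "w - y"] by (simp add: lin)
qed

text \<open>
  Arbitrary filters below \<^term>\<open>sequentially\<close> play the role of subsequences. Along each of
  them the asymptotic center is represented in \<open>Z\<close>, and the convergence of the distances to
  \<open>Z\<close> forces all these centers to have the same asymptotic radius; failure of weak convergence
  in a direction \<open>z\<close> would let one decrease that radius by moving along \<open>z\<close>.
\<close>
lemma Opial_asymptotic_center:
  fixes x :: "nat \<Rightarrow> 'a"
  assumes K: "\<And>k. norm (Q (x k)) \<le> K"
    and lim: "\<And>y. y \<in> Z \<Longrightarrow> convergent (\<lambda>k. q (x k - y))"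
    and center: "\<And>F w. F \<noteq> bot \<Longrightarrow> F \<le> sequentially \<Longrightarrow>
      (\<And>v. real_limsup F (\<lambda>k. q (x k - w)) \<le> real_limsup F (\<lambda>k. q (x k - v))) \<Longrightarrow>
      \<exists>y\<in>Z. Q y = Q w"
  shows "\<exists>y\<in>Z. weakly_converges (\<lambda>k. Q (x k)) (Q y)"
proof -
  define R where "R F w = real_limsup F (\<lambda>k. q (x k - w))" for F w
  have ex_center: "\<exists>y\<in>Z. \<forall>v. R F y \<le> R F v" if F: "F \<noteq> bot" "F \<le> sequentially" for F
  proof -
    obtain w where w: "\<And>v. R F w \<le> R F v"
      using asymptotic_center[where x = x, OF F(1) K] unfolding R_def by blast
    then obtain y where y: "y \<in> Z" "Q y = Q w"
      using center[OF F] unfolding R_def by blast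
    have "R F y = R F w" unfolding R_def by (simp only: q_eq_modulo_ker[OF y(2)])
    then have "R F y \<le> R F v" for v using w[of v] by simp
    then show ?thesis using y(1) by blast
  qed
  obtain y0 where y0: "y0 \<in> Z" "\<And>v. R sequentially y0 \<le> R sequentially v"
    using ex_center[of sequentially] by auto
  have R_eq: "R F y = R sequentially y"
    if F: "F \<noteq> bot" "F \<le> sequentially" and y: "y \<in> Z" for F y
  proof -
    obtain l where l: "(\<lambda>k. q (x k - y)) \<longlonglongrightarrow> l"
      using lim[OF y] convergent_def by blast
    show ?thesis unfolding R_def
      using real_limsup_eq_lim[OF F(1) psd tendsto_mono[OF F(2) l]]
        real_limsup_eq_lim[OF sequentially_bot psd l] by simp
  qed
  have ev_less: "\<forall>\<^sub>F k in sequentially. inner (Q (x k - y0)) z < e" if "e > 0" for e z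
  proof (rule ccontr)
    assume neg: "\<not> (\<forall>\<^sub>F k in sequentially. inner (Q (x k - y0)) z < e)"
    \<comment> \<open>The filter concentrates on the indices where the inequality fails; it is
      proper because these occur arbitrarily late.\<close>
    define F where "F = inf sequentially (principal {k. \<not> inner (Q (x k - y0)) z < e})"
    have F: "F \<noteq> bot" "F \<le> sequentially"
      using neg unfolding F_def
      by (auto simp: trivial_limit_def eventually_inf_principal elim: eventually_mono)
    have Fge: "\<forall>\<^sub>F k in F. e \<le> inner (Q (x k - y0)) z"
      unfolding F_def eventually_inf_principal by simp
    obtain y1 where y1: "y1 \<in> Z" "\<And>v. R F y1 \<le> R F v"
      using ex_center[OF F] by blast
    \<comment> \<open>On \<open>Z\<close> the radii along \<open>F\<close> and along the full
      sequence coincide, so \<open>y0\<close> is a center along \<open>F\<close> too.\<close>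
    have y0_min: "R F y0 \<le> R F v" for v
      using y1(2)[of v] y0(2)[of y1] R_eq[OF F y0(1)] R_eq[OF F y1(1)] by linarith
    \<comment> \<open>Nearly the minimizer \<open>e / q z\<close> of
      \<open>t\<^sup>2 * q z - 2 * t * e\<close>; the added 1 covers \<open>q z = 0\<close> and
      still leaves a negative value.\<close>
    define t where "t = e / (q z + 1)"
    have qz: "q z + 1 > 0" using psd[of z] by linarith
    then have t: "t > 0" using \<open>e > 0\<close> by (simp add: t_def)
    have "R F (y0 + t *\<^sub>R z) \<le> R F y0 + (t\<^sup>2 * q z - 2 * t * e)"
      unfolding R_def
    proof (rule real_limsup_le_add[OF F(1) psd])
      show "\<forall>\<^sub>F k in F. q (x k - y0) \<le> (K + norm (Q y0))\<^sup>2 / \<nu>"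
        using q_bounded[OF K] by simp
      fix d :: real assume "d > 0"
      show "\<forall>\<^sub>F k in F. q (x k - (y0 + t *\<^sub>R z)) \<le> q (x k - y0) + (t\<^sup>2 * q z - 2 * t * e) + d"
        using Fge
      proof eventually_elim
        case (elim k)
        have "q (x k - (y0 + t *\<^sub>R z)) = q ((x k - y0) - t *\<^sub>R z)"
          by (simp add: algebra_simps)
        also have "\<dots> = q (x k - y0) - 2 * t * inner (Q (x k - y0)) z + t\<^sup>2 * q z"
          unfolding q_diff[of "x k - y0" "t *\<^sub>R z"] q_scale by simp
        finally show ?case
          using mult_left_mono[OF elim, of "2 * t"] t \<open>d > 0\<close> by linarith
      qed
    qed
    with y0_min[of "y0 + t *\<^sub>R z"] have "2 * t * e \<le> t\<^sup>2 * q z" by linarith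
    then have "2 * e \<le> t * q z" using t by (simp add: power2_eq_square)
    moreover have "t * (q z + 1) = e" using qz by (simp add: t_def)
    ultimately show False using t \<open>e > 0\<close> by (simp add: algebra_simps)
  qed
  have "(\<lambda>k. inner (Q (x k)) z) \<longlonglongrightarrow> inner (Q y0) z" for z
  proof (rule tendstoI)
    fix e :: real assume "e > 0"
    show "\<forall>\<^sub>F k in sequentially. dist (inner (Q (x k)) z) (inner (Q y0) z) < e"
      \<comment> \<open>The direction \<open>- z\<close> supplies the bound from below.\<close>
      using ev_less[OF \<open>e > 0\<close>, of z] ev_less[OF \<open>e > 0\<close>, of "- z"]
      by eventually_elim (auto simp: dist_real_def lin inner_simps)
  qed
  then show ?thesis using y0(1) unfolding weakly_converges_def by blast
qed

end

section \<open>Averagedness of the forward-backward operator\<close>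

lemma fb_op_iff: "x' \<in> fb_op A B Q x \<longleftrightarrow> Q x - B x - Q x' \<in> A x'"
proof -
  have "Q x - B x \<in> A x' + {Q x'} \<longleftrightarrow> (\<exists>a\<in>A x'. a = Q x - B x - Q x')"
    unfolding set_plus_def by (simp add: eq_diff_eq eq_commute)
  then show ?thesis by (simp add: fb_op_def op_inverse_def)
qed

lemma zer_plus_iff:
  fixes B :: "'a \<Rightarrow> 'b::ab_group_add"
  shows "y \<in> zer (\<lambda>y. A y + {B y}) \<longleftrightarrow> - B y \<in> A y"
proof -
  have "0 \<in> A y + {B y} \<longleftrightarrow> (\<exists>a\<in>A y. 0 = a + B y)"
    by (simp add: set_plus_def)
  also have "\<dots> \<longleftrightarrow> - B y \<in> A y"
    by (metis eq_neg_iff_add_eq_0)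
  finally show ?thesis by (simp add: zer_def)
qed

lemma zer_fixed_point: "y \<in> zer (\<lambda>y. A y + {B y}) \<Longrightarrow> y \<in> fb_op A B Q y"
  unfolding zer_plus_iff fb_op_iff by simp

context psd_closed_range
begin

text \<open>Split \<open>e'\<close> as \<open>(x - y) - d\<close>. Cocoercivity makes the first part
  contribute at least \<open>P\<close>, while Cauchy-Schwarz and the arithmetic-geometric mean
  inequality bound the second by \<open>P + R\<close>; the two copies of \<open>P\<close>
  cancel.\<close>

lemma cocoercive_cross_term:
  assumes "\<beta> \<ge> 0" and coc: "inv_cocoercive \<beta> B" and ran: "range B \<subseteq> range Q"
  shows "inner e' (B x - B y) \<ge> - (\<beta> / (4 * \<nu>) * q ((x - y) - e'))"
proof (cases "\<beta> = 0")
  case True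
  then show ?thesis using coc by (simp add: inv_cocoercive_def)
next
  case False
  then have "\<beta> > 0" using \<open>\<beta> \<ge> 0\<close> by simp
  define b d where "b = B x - B y" and "d = (x - y) - e'"
  obtain u v where "B x = Q u" "B y = Q v" using ran by blast
  then have b: "b = Q (u - v)" by (simp add: b_def lin)
  define P R s where "P = (norm b)\<^sup>2 / \<beta>" and "R = \<beta> / (4 * \<nu>) * q d" and "s = inner d b"
  have PR: "P \<ge> 0" "R \<ge> 0" using \<open>\<beta> > 0\<close> \<nu>_pos psd by (auto simp: P_def R_def)
  have "s\<^sup>2 \<le> q d * q (u - v)"
    using Cauchy_Schwarz[of "u - v" d] by (simp add: s_def b inner_commute mult.commute)
  also have "\<dots> \<le> q d * ((norm b)\<^sup>2 / \<nu>)"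
    unfolding b by (intro mult_left_mono q_le_norm psd)
  also have "\<dots> = 4 * P * R"
    using \<open>\<beta> > 0\<close> \<nu>_pos by (simp add: P_def R_def field_simps)
  also have "\<dots> \<le> (P + R)\<^sup>2"
    using zero_le_power2[of "P - R"] by (simp add: power2_eq_square algebra_simps)
  finally have "s \<le> P + R" by (rule power2_le_imp_le) (use PR in simp)
  moreover have "inner (x - y) b \<ge> P"
    using coc False unfolding inv_cocoercive_def b_def P_def by (simp add: divide_inverse mult.commute)
  moreover have "inner e' b = inner (x - y) b - s"
    by (simp add: s_def d_def inner_simps)
  ultimately show ?thesis by (simp add: b_def d_def R_def)
qed

text \<open>Monotonicity of \<open>A\<close> is tested on the two resolvent inclusions and
  polarized. Doubling the cross-term loss \<open>\<beta> / (4 * \<nu>)\<close> gives the constant in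
  the conclusion.\<close>

lemma fb_op_averaged:
  assumes "\<beta> \<ge> 0" and "inv_cocoercive \<beta> B" and "range B \<subseteq> range Q" and mono: "monotone_op A"
    and x': "x' \<in> fb_op A B Q x" and y': "y' \<in> fb_op A B Q y"
  shows "q (x' - y') \<le> q (x - y) - (1 - \<beta> / (2 * \<nu>)) * q ((x - x') - (y - y'))"
proof -
  define e e' where "e = x - y" and "e' = x' - y'"
  have de: "(x - x') - (y - y') = e - e'" by (simp add: e_def e'_def)
  have "0 \<le> inner (x' - y') ((Q x - B x - Q x') - (Q y - B y - Q y'))"
    using mono x' y' unfolding monotone_op_def fb_op_iff by blast
  also have "(Q x - B x - Q x') - (Q y - B y - Q y') = Q (e - e') - (B x - B y)"
    by (simp add: e_def e'_def lin)
  finally have "0 \<le> inner e' (Q (e - e')) - inner e' (B x - B y)"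
    by (simp add: e'_def inner_simps)
  moreover have "inner e' (B x - B y) \<ge> - (\<beta> / (4 * \<nu>) * q (e - e'))"
    using cocoercive_cross_term[OF assms(1-3)] by (simp add: e_def)
  ultimately have "0 \<le> inner e' (Q (e - e')) + \<beta> / (4 * \<nu>) * q (e - e')"
    by linarith
  moreover have "2 * inner e' (Q (e - e')) = q e - q e' - q (e - e')"
    using sym[of e e'] by (simp add: q_diff lin inner_simps inner_commute[of e'])
  ultimately have "0 \<le> q e - q e' - q (e - e') + \<beta> / (2 * \<nu>) * q (e - e')"
    by (simp add: field_simps)
  then show ?thesis unfolding de by (simp add: e_def[symmetric] e'_def[symmetric] algebra_simps)
qed

end

section \<open>Summability, rate and weak limit of the iteration\<close>

theorem theorem3p1:
  fixes A :: "'a::{real_inner, complete_space} \<Rightarrow> 'a set"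
    and B Q :: "'a \<Rightarrow> 'a"
    and \<beta> \<nu> :: real
    and x :: "nat \<Rightarrow> 'a"
  assumes "maximally_monotone A"
    and "bounded_linear Q" and "self_adjoint Q"
    and "degenerate Q"
    and "closed (range Q)"
    and "\<beta> \<ge> 0" and "inv_cocoercive \<beta> B"
    and "range B \<subseteq> range Q"
    and "op_ran (\<lambda>y. A y + {Q y}) \<supseteq> range (\<lambda>y. Q y - B y)"
    and "zer (\<lambda>y. A y + {B y}) \<noteq> {}"
    and "\<nu> > 0" and "\<forall>y \<in> orthogonal_comp (op_ker Q). norm (Q y) \<ge> \<nu> * norm y"
    and "\<forall>k. x (Suc k) \<in> fb_op A B Q (x k)"
    and "\<nu> > \<beta> / 2"
  shows "summable (\<lambda>k. (qnorm Q (x (Suc k) - x k))\<^sup>2)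
    \<and> (\<lambda>k. Q (x k - x (Suc k))) \<longlonglongrightarrow> 0
    \<and> (\<forall>xs \<in> zer (\<lambda>y. A y + {B y}). \<forall>k.
         qnorm Q (x (Suc k) - x k)
           \<le> 1 / sqrt (real k + 1) * sqrt (2 * \<nu> / (2 * \<nu> - \<beta>)) * qnorm Q (x 0 - xs))
    \<and> (\<exists>xs \<in> zer (\<lambda>y. A y + {B y}). weakly_converges (\<lambda>k. Q (x k)) (Q xs))"
proof -
  interpret psd_closed_range Q \<nu>
    by (rule psd_closed_range.intro) (use assms in \<open>auto simp: degenerate_def\<close>)
  let ?Z = "zer (\<lambda>y. A y + {B y})"
  \<comment> \<open>Positivity of \<open>c\<close> is the condition
    \<open>\<nu> > \<beta> / 2\<close>, and \<open>1 / c\<close> is the fraction under the root in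
    the rate.\<close>
  define c where "c = 1 - \<beta> / (2 * \<nu>)"
  define D where "D k = q (x (Suc k) - x k)" for k
  have c: "c > 0" using assms by (simp add: c_def field_simps)
  have mono: "monotone_op A" using assms(1) by (simp add: maximally_monotone_def)
  have iter: "x (Suc k) \<in> fb_op A B Q (x k)" for k using assms by blast
  have averaged: "q (x' - y') \<le> q (u - y) - c * q ((u - x') - (y - y'))"
    if "x' \<in> fb_op A B Q u" "y' \<in> fb_op A B Q y" for x' y' u y
    unfolding c_def by (rule fb_op_averaged[OF assms(6-8) mono that])
  have nonexp: "q (x' - y') \<le> q (u - y)"
    if "x' \<in> fb_op A B Q u" "y' \<in> fb_op A B Q y" for x' y' u y
    using averaged[OF that] mult_nonneg_nonneg[OF less_imp_le[OF c] psd] by (smt (verit))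
  have D_nonneg: "0 \<le> D k" for k by (simp add: D_def psd)
  \<comment> \<open>Consecutive differences are differences of images, so nonexpansiveness applies
    to the orbit against its own shift.\<close>
  have D_decr: "D (Suc k) \<le> D k" for k
    unfolding D_def by (rule nonexp[OF iter iter])
  then have D_anti: "D k \<le> D i" if "i \<le> k" for i k
    using that by (rule lift_Suc_antimono_le)
  have Fejer: "q (x (Suc k) - y) \<le> q (x k - y) - c * D k" if "y \<in> ?Z" for k y
    using averaged[OF iter zer_fixed_point[OF that], of k] by (simp add: D_def q_commute[of "x k"])
  have partial: "c * (\<Sum>i<n. D i) \<le> q (x 0 - y) - q (x n - y)" if "y \<in> ?Z" for n y
  proof (induction n)
    case (Suc n)
    then show ?case using Fejer[OF that, of n] by (simp add: distrib_left)
  qed simp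
  have partial_le: "c * (\<Sum>i<n. D i) \<le> q (x 0 - y)" if "y \<in> ?Z" for n y
    using partial[OF that, of n] psd[of "x n - y"] by linarith
  obtain y0 where y0: "y0 \<in> ?Z" using assms by blast
  have sumD: "summable D"
  proof (rule bounded_imp_summable[OF D_nonneg])
    show "(\<Sum>i\<le>n. D i) \<le> q (x 0 - y0) / c" for n
      using partial_le[OF y0, of "Suc n"] c
      by (simp add: pos_le_divide_eq mult.commute lessThan_Suc_atMost)
  qed
  then have D0: "D \<longlonglongrightarrow> 0" by (rule summable_LIMSEQ_zero)
  have part1: "summable (\<lambda>k. (qnorm Q (x (Suc k) - x k))\<^sup>2)"
    using sumD unfolding D_def qnorm_sq .
  have part2: "(\<lambda>k. Q (x k - x (Suc k))) \<longlonglongrightarrow> 0"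
  proof -
    have "norm (Q (x k - x (Suc k))) \<le> sqrt (onorm Q * D k)" for k
      using norm_Q_le[of "x k - x (Suc k)"]
      by (intro real_le_rsqrt) (simp add: D_def q_commute[of "x k"])
    moreover have "(\<lambda>k. sqrt (onorm Q * D k)) \<longlonglongrightarrow> sqrt (onorm Q * 0)"
      by (intro tendsto_intros D0)
    ultimately show ?thesis
      using Lim_null_comparison[of "\<lambda>k. Q (x k - x (Suc k))" "\<lambda>k. sqrt (onorm Q * D k)" sequentially]
      by simp
  qed
  have part3: "qnorm Q (x (Suc k) - x k)
      \<le> 1 / sqrt (real k + 1) * sqrt (2 * \<nu> / (2 * \<nu> - \<beta>)) * qnorm Q (x 0 - y)"
    if "y \<in> ?Z" for y k
  proof -
    \<comment> \<open>\<open>D k\<close> is the smallest of the \<open>k + 1\<close> steps up to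
      index \<open>k\<close>; this is where the factor \<open>k + 1\<close> of the rate comes
      from.\<close>
    have "real (Suc k) * D k \<le> (\<Sum>i<Suc k. D i)"
      using sum_bounded_below[of "{..<Suc k}" "D k" D] D_anti by simp
    then have "c * (real (Suc k) * D k) \<le> q (x 0 - y)"
      using partial_le[OF that, of "Suc k"] c by (meson mult_left_mono less_imp_le order_trans)
    moreover have "d \<le> 1 / N * (1 / c) * E" if "c * (N * d) \<le> E" "N > 0" for d E N
      using that c by (simp add: field_simps)
    ultimately have "D k \<le> 1 / real (Suc k) * (1 / c) * q (x 0 - y)"
      by (meson of_nat_0_less_iff zero_less_Suc)
    then have "D k \<le> 1 / (real k + 1) * (1 / c) * q (x 0 - y)"
      by (simp only: of_nat_Suc add.commute)
    also have "1 / c = 2 * \<nu> / (2 * \<nu> - \<beta>)"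
      using assms by (simp add: c_def field_simps)
    finally have "sqrt (D k) \<le> sqrt (1 / (real k + 1) * (2 * \<nu> / (2 * \<nu> - \<beta>)) * q (x 0 - y))"
      by (rule real_sqrt_le_mono)
    then show ?thesis
      by (simp only: D_def qnorm_def real_sqrt_mult real_sqrt_divide real_sqrt_one)
  qed
  have decr: "q (x (Suc k) - y) \<le> q (x k - y)" if "y \<in> ?Z" for k y
    by (rule nonexp[OF iter zer_fixed_point[OF that]])
  have lim: "convergent (\<lambda>k. q (x k - y))" if "y \<in> ?Z" for y
  proof -
    have "decseq (\<lambda>k. q (x k - y))" by (rule decseq_SucI) (rule decr[OF that])
    then show ?thesis
      using decseq_convergent[of "\<lambda>k. q (x k - y)" 0] psd convergentI by metis
  qed
  define K where "K = sqrt (onorm Q * q (x 0 - y0)) + norm (Q y0)"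
  have K: "norm (Q (x k)) \<le> K" for k
  proof -
    have "q (x k - y0) \<le> q (x 0 - y0)"
      by (rule lift_Suc_antimono_le[of "\<lambda>k. q (x k - y0)"]) (auto intro: decr[OF y0])
    then have "onorm Q * q (x k - y0) \<le> onorm Q * q (x 0 - y0)"
      by (simp add: mult_left_mono onorm_pos_le bounded_linear)
    then have "norm (Q (x k - y0)) \<le> sqrt (onorm Q * q (x 0 - y0))"
      using norm_Q_le[of "x k - y0"] by (intro real_le_rsqrt) linarith
    then show ?thesis
      using norm_triangle_ineq2[of "Q (x k)" "Q y0"] by (simp add: K_def lin)
  qed
  \<comment> \<open>The center \<open>w\<close> itself need not be a zero. One application of the
    operator gives \<open>y\<close> with no larger radius, hence the same image under
    \<open>Q\<close>, and this \<open>y\<close> solves the inclusion.\<close>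
  have center: "\<exists>y\<in>?Z. Q y = Q w"
    if F: "F \<noteq> bot" "F \<le> sequentially"
      and min: "\<And>v. real_limsup F (\<lambda>k. q (x k - w)) \<le> real_limsup F (\<lambda>k. q (x k - v))" for F w
  proof -
    have "Q w - B w \<in> op_ran (\<lambda>y. A y + {Q y})" using assms by blast
    then obtain y where y: "y \<in> fb_op A B Q w"
      unfolding op_ran_def fb_op_def op_inverse_def by blast
    define M where "M = (K + norm (Q w))\<^sup>2 / \<nu>"
    have M: "q (x k - w) \<le> M" for k unfolding M_def by (rule q_bounded[OF K])
    \<comment> \<open>Nonexpansiveness compares \<open>y\<close> with \<open>x (Suc k)\<close>;
      expanding around that point returns to \<open>x k\<close> at the cost of a term that vanishes
      with \<open>D k\<close>.\<close>
    have step: "q (x k - y) \<le> q (x k - w) + (D k + 2 * sqrt (D k * M))" for k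
    proof -
      have qy: "q (x (Suc k) - y) \<le> q (x k - w)" by (rule nonexp[OF iter y])
      have "(inner (Q (x k - x (Suc k))) (x (Suc k) - y))\<^sup>2 \<le> D k * q (x (Suc k) - y)"
        using Cauchy_Schwarz[of "x k - x (Suc k)" "x (Suc k) - y"]
        by (simp add: D_def q_commute[of "x k"])
      also have "\<dots> \<le> D k * M"
        using qy M[of k] by (intro mult_left_mono D_nonneg) linarith
      finally have "inner (Q (x k - x (Suc k))) (x (Suc k) - y) \<le> sqrt (D k * M)"
        by (rule real_le_rsqrt)
      moreover have "q (x k - y)
          = D k + 2 * inner (Q (x k - x (Suc k))) (x (Suc k) - y) + q (x (Suc k) - y)"
        using q_add[of "x k - x (Suc k)" "x (Suc k) - y"]
        by (simp add: D_def q_commute[of "x k" "x (Suc k)"])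
      ultimately show ?thesis using qy by linarith
    qed
    have "(\<lambda>k. D k + 2 * sqrt (D k * M)) \<longlonglongrightarrow> 0 + 2 * sqrt (0 * M)"
      by (intro tendsto_intros D0)
    then have err: "((\<lambda>k. D k + 2 * sqrt (D k * M)) \<longlongrightarrow> 0) F"
      using tendsto_mono[OF F(2)] by simp
    have "real_limsup F (\<lambda>k. q (x k - y)) \<le> real_limsup F (\<lambda>k. q (x k - w)) + 0"
    proof (rule real_limsup_le_add[OF F(1) psd])
      show "\<forall>\<^sub>F k in F. q (x k - w) \<le> M" using M by simp
      fix e :: real assume "e > 0"
      show "\<forall>\<^sub>F k in F. q (x k - y) \<le> q (x k - w) + 0 + e"
        using order_tendstoD(2)[OF err \<open>e > 0\<close>]
      proof eventually_elim
        case (elim k)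
        then show ?case using step[of k] by linarith
      qed
    qed
    then have Qy: "Q y = Q w"
      unfolding add_0_right by (rule asymptotic_center_unique[where x = x, OF F(1) K min])
    \<comment> \<open>The values of \<open>B\<close> lie in the range of \<open>Q\<close>, so
      \<open>B y - B w\<close> is orthogonal to the kernel element \<open>y - w\<close>, and
      cocoercivity forces it to vanish.\<close>
    have "B y = B w"
    proof (cases "\<beta> = 0")
      case True
      then show ?thesis using assms(7) by (simp add: inv_cocoercive_def)
    next
      case False
      obtain u v where "B y = Q u" "B w = Q v" using assms(8) by blast
      then have "inner (y - w) (B y - B w) = inner (Q (y - w)) (u - v)"
        using sym[of "u - v" "y - w"] by (simp add: lin inner_commute)
      also have "\<dots> = 0" using Qy by (simp add: lin)
      finally have "inverse \<beta> * (norm (B y - B w))\<^sup>2 \<le> 0"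
        using assms(7) False unfolding inv_cocoercive_def by metis
      moreover have "inverse \<beta> > 0" using False assms(6) by simp
      ultimately have "(norm (B y - B w))\<^sup>2 \<le> 0"
        by (simp add: mult_le_0_iff)
      then show ?thesis by simp
    qed
    \<comment> \<open>With \<open>Q y = Q w\<close> and \<open>B y = B w\<close> the resolvent
      inclusion \<open>Q w - B w - Q y \<in> A y\<close> reduces to
      \<open>- B y \<in> A y\<close>.\<close>
    then have "y \<in> ?Z" using y Qy unfolding fb_op_iff zer_plus_iff by simp
    then show ?thesis using Qy by blast
  qed
  have part4: "\<exists>xs\<in>?Z. weakly_converges (\<lambda>k. Q (x k)) (Q xs)"
    by (rule Opial_asymptotic_center[OF K lim center])
  show ?thesis using part1 part2 part3 part4 by blast
qed

end
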